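(* Let $N\in\mathbb{N}$ and $a,b,c\in\mathbb{N}$ with $0\le a\le N$, $0\le b\le N$, $a\le b$, $N\le a+b$ and $0\le c\le N-b$. Then $$\sum_{m=0}^c\frac{(-c)_m\,(b+1)_m\,(b+1)_m}{(N-a-c+1)_m\,m!\,(b-N)_m}\;{}_4F_3\left(\begin{matrix}-b,\;N-a-b-c,\;N-b-m+1,\;N-b-m+1\\N-b-c+1,\;-b-m,\;-b-m\end{matrix};1\right)$$ $$=\frac{\binom{N+1}{a}}{\binom{b}{N-a-c}\binom{N-b}{N-b-c}}\sum_{n=0}^c\frac{(-a)_{N-b-n}\,(-1)^{N-b-n}\,(N+2-n)_n}{(N-a+2)_{N-b-n}\,n!}.$$
   Context: $\mathbb{N}=\{0,1,2,\dots\}$; $(x)_k=x(x+1)\cdots(x+k-1)$, $(x)_0=1$. ${}_4F_3\left(\begin{smallmatrix}\alpha_1,\alpha_2,\alpha_3,\alpha_4\\\beta_1,\beta_2,\beta_3\end{smallmatrix};z\right)=\sum_{k\ge0}\frac{(\alpha_1)_k(\alpha_2)_k(\alpha_3)_k(\alpha_4)_k}{(\beta_1)_k(\beta_2)_k(\beta_3)_k\,k!}z^k$; here the series terminates because of the upper parameters $-b$ and $N-a-b-c$, which are nonpositive integers (only terms up to the first vanishing of the numerator, i.e. $k\le\min(b,a+b+c-N)$, are included). *)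

theory Defs
  imports Complex_Main
begin

text \<open>
  The full series is used also in the terminating case. If an upper parameter is a nonpositive
  integer, every term from the first vanishing of the numerator on is 0, including those whose
  denominator vanishes as well, because \<open>x / 0 = 0\<close>. Hence exactly the terms up to that point
  are summed, which is the usual convention when a lower parameter is also a negative integer.
\<close>

definition hypergeo_4F3 ::
  "real \<Rightarrow> real \<Rightarrow> real \<Rightarrow> real \<Rightarrow> real \<Rightarrow> real \<Rightarrow> real \<Rightarrow> real \<Rightarrow> real" where
  "hypergeo_4F3 \<alpha>1 \<alpha>2 \<alpha>3 \<alpha>4 \<beta>1 \<beta>2 \<beta>3 z =
     (\<Sum>k. (pochhammer \<alpha>1 k * pochhammer \<alpha>2 k * pochhammer \<alpha>3 k * pochhammer \<alpha>4 k) /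
           (pochhammer \<beta>1 k * pochhammer \<beta>2 k * pochhammer \<beta>3 k * fact k) * z ^ k)"

end

theory Submission
  imports
    Defs
    "HOL-Computational_Algebra.Formal_Power_Series"
    "HOL-Computational_Algebra.Polynomial"
begin

text \<open>
  Put \<open>p = N - a - c\<close>, \<open>q = a + b + c - N\<close> and \<open>h = N - b - c\<close>, so that \<open>b = p + q\<close>, \<open>a = q + h\<close>,
  \<open>N = p + q + h + c\<close> and \<open>c \<le> q\<close>. Written with factorials and cleared of the two binomial
  coefficients in the denominator of the prefactor, both sides lose all their signs and, with
  \<open>i = c - m\<close> and \<open>j = c - n\<close>, the claim becomes
  \[ \sum_{i \le c} \sum_{k \le q} \binom{h+i+k}{i} \binom{h+i+k}{k}
       \binom{p+c-i+q-k}{c-i} \binom{p+c-i+q-k}{q-k}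
     = \sum_{j \le c} \binom{N+1}{c-j} \binom{N+1}{q-j}. \]

  The product of the first two binomial coefficients is the coefficient of \<open>u^i s^(i+k)\<close> in
  \<open>P^(h+i+k)\<close> for \<open>P = (1 + u s)(1 + s)\<close>, and the other two arise in the same way from \<open>p\<close>. So the left
  side is the coefficient of \<open>u^c\<close> in a convolution of two sequences \<open>[s^k] P^(h+k)\<close> and
  \<open>[s^k] P^(p+k)\<close>. By Lagrange inversion, if \<open>\<phi> = t P(\<phi>)\<close> then
  \<open>\<Sum>k. [s^k] P^(h+k) t^(h+k) = \<phi>^h / (1 - t P'(\<phi>))\<close>; the product of two such series depends on
  \<open>h + p\<close> only, and expanding \<open>\<phi>^(h+p) / (1 - t P'(\<phi>))\<^sup>2\<close> by the same principle gives a Jensen-type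
  convolution identity for an arbitrary power series \<open>P\<close> (lemma \<open>diag_convolution\<close>):
  \[ \sum_{k \le n} [s^k] P^{h+k} \, [s^{n-k}] P^{p+n-k} = [s^n] \frac{P^{n+h+p+1}}{P - s P'}. \]
  For the present \<open>P\<close> the denominator is \<open>1 - u s^2\<close>, and its geometric series produces the single sum
  over \<open>j\<close> on the right.
\<close>

section \<open>A convolution identity for diagonal coefficients\<close>

unbundle fps_syntax

text \<open>
  For the solution \<open>\<phi>\<close> of \<open>\<phi> = t P(\<phi>)\<close> these are the coefficients, at \<open>t^(h+k)\<close>, of
  \<open>\<phi>^h / (1 - t P'(\<phi>))\<close>.
\<close>
definition diag_coeff :: "'a::comm_ring_1 fps \<Rightarrow> nat \<Rightarrow> nat \<Rightarrow> 'a" where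
  "diag_coeff P h k = (P ^ (h + k)) $ k"

lemma diag_coeff_Suc:
  "diag_coeff P (Suc h) k = (\<Sum>j\<le>k. P $ j * diag_coeff P (h + j) (k - j))"
  by (simp add: diag_coeff_def fps_mult_nth atLeast0AtMost)

text \<open>
  The recurrence above does not reach \<open>h = 0\<close>, where it would need a negative power of \<open>P\<close>. There the
  coefficient of \<open>s^(k+1)\<close> is read off from the derivative of \<open>P^(k+1)\<close> instead; the factor
  \<open>k + 1\<close> occurs on both sides and cancels in characteristic 0.
\<close>
lemma diag_coeff_0_Suc:
  fixes P :: "'a::{idom,ring_char_0} fps"
  shows "diag_coeff P 0 (Suc k) = (\<Sum>j\<le>k. fps_deriv P $ j * diag_coeff P j (k - j))"
proof -
  have "of_nat (Suc k) * (P ^ Suc k) $ Suc k = fps_deriv (P ^ Suc k) $ k"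
    by (simp only: fps_deriv_nth Suc_eq_plus1)
  also have "\<dots> = of_nat (Suc k) * (fps_deriv P * P ^ k) $ k"
    by (simp only: fps_deriv_power' diff_Suc_1 mult.assoc fps_mult_of_nat_nth)
  finally have "(P ^ Suc k) $ Suc k = (fps_deriv P * P ^ k) $ k"
    by (metis mult_cancel_left of_nat_eq_0_iff nat.distinct(1))
  then show ?thesis
    by (simp add: diag_coeff_def fps_mult_nth atLeast0AtMost del: power_Suc)
qed

lemma sum_triangle_shift:
  fixes f :: "nat \<Rightarrow> nat \<Rightarrow> 'a::comm_semiring_1" and g :: "nat \<Rightarrow> 'a"
  shows "(\<Sum>k\<le>n. (\<Sum>j\<le>k. f j (k - j)) * g (n - k)) = (\<Sum>j\<le>n. \<Sum>k\<le>n - j. f j k * g (n - j - k))"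
proof -
  have "(\<Sum>k\<le>n. (\<Sum>j\<le>k. f j (k - j)) * g (n - k))
      = (\<Sum>k\<le>n. \<Sum>j\<le>k. f j (k - j) * g (n - j - (k - j)))"
    by (intro sum.cong refl) (auto simp: sum_distrib_right intro!: sum.cong)
  also have "\<dots> = (\<Sum>(j, k)\<in>{(i, j). i + j \<le> n}. f j k * g (n - j - k))"
    by (simp add: sum.triangle_reindex_eq)
  also have "{(i, j). i + j \<le> n} = Sigma {..n} (\<lambda>j. {..n - j})"
    by auto
  finally show ?thesis
    by (simp add: sum.Sigma)
qed

text \<open>
  Both sides satisfy the same recurrence in \<open>h\<close>, obtained by splitting off one factor \<open>P\<close>; it lowers
  \<open>n\<close> in every term except the one with \<open>P $ 0\<close>, which lowers \<open>h\<close>. As the left side is symmetric in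
  \<open>h\<close> and \<open>p\<close>, only \<open>h = p = 0\<close> remains, and there the recurrence from the derivative of \<open>P\<close> applies.
  The series \<open>Q\<close> stands for \<open>1 / (P - s P')\<close>.
\<close>
lemma diag_convolution:
  fixes P Q :: "'a::{idom,ring_char_0} fps"
  assumes PQ: "(P - fps_X * fps_deriv P) * Q = 1"
  shows "(\<Sum>k\<le>n. diag_coeff P h k * diag_coeff P p (n - k)) = (P ^ (n + h + p + 1) * Q) $ n"
proof -
  define J where "J h p n = (\<Sum>k\<le>n. diag_coeff P h k * diag_coeff P p (n - k))" for h p n
  define E where "E H n = (P ^ (n + H + 1) * Q) $ n" for H n
  have J_commute: "J h p n = J p h n" for h p n
    unfolding J_def
    by (rule sum.reindex_bij_witness[of _ "\<lambda>k. n - k" "\<lambda>k. n - k"]) auto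
  have J_Suc: "J (Suc h) p n = (\<Sum>j\<le>n. P $ j * J (h + j) p (n - j))" for h p n
    unfolding J_def diag_coeff_Suc
      sum_triangle_shift[of "\<lambda>j k. P $ j * diag_coeff P (h + j) k" "diag_coeff P p"]
    by (simp add: sum_distrib_left mult.assoc)
  have E_Suc: "E (Suc H) n = (\<Sum>j\<le>n. P $ j * E (H + j) (n - j))" for H n
  proof -
    have "E (Suc H) n = (P * (P ^ (n + H + 1) * Q)) $ n"
      by (simp add: E_def mult_ac)
    then show ?thesis
      by (simp add: E_def fps_mult_nth[of P] atLeast0AtMost)
  qed
  have "J h p n = E (h + p) n" for h p
  proof (induction n arbitrary: h p rule: less_induct)
    case (less n)
    have step: "J (Suc h) p n = E (Suc h + p) n" if "J h p n = E (h + p) n" for h p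
    proof -
      have "J (h + j) p (n - j) = E (h + p + j) (n - j)" if "j \<le> n" for j
        using \<open>J h p n = E (h + p) n\<close> less.IH[of "n - j" "h + j" p] that
        by (cases j) (auto simp: add_ac)
      then show ?thesis
        by (simp add: J_Suc E_Suc)
    qed
    have base: "J 0 0 n = E 0 n"
    proof (cases n)
      case 0
      have "P $ 0 * Q $ 0 = 1"
        using arg_cong[OF PQ, of "\<lambda>F. F $ 0"] by simp
      then show ?thesis
        by (simp add: 0 J_def E_def diag_coeff_def)
    next
      case (Suc m)
      have "J 0 0 n = (P ^ n) $ n + (\<Sum>k\<le>m. diag_coeff P 0 (Suc k) * diag_coeff P 0 (m - k))"
        by (simp add: J_def Suc sum.atMost_Suc_shift diag_coeff_def del: sum.atMost_Suc)
      also have "(\<Sum>k\<le>m. diag_coeff P 0 (Suc k) * diag_coeff P 0 (m - k))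
          = (\<Sum>j\<le>m. fps_deriv P $ j * J j 0 (m - j))"
        unfolding diag_coeff_0_Suc
          sum_triangle_shift[of "\<lambda>j k. fps_deriv P $ j * diag_coeff P j k" "diag_coeff P 0"] J_def
        by (simp add: sum_distrib_left mult.assoc)
      also have "\<dots> = (\<Sum>j\<le>m. fps_deriv P $ j * (P ^ n * Q) $ (m - j))"
        using Suc by (intro sum.cong refl) (simp add: less.IH E_def)
      also have "\<dots> = (fps_X * fps_deriv P * (P ^ n * Q)) $ n"
        by (simp add: Suc mult.assoc fps_mult_nth[of "fps_deriv P"] atLeast0AtMost del: power_Suc)
      \<comment> \<open>Inserting \<open>1 = (P - s P') Q\<close> into the remaining term \<open>k = 0\<close> cancels the derivative.\<close>
      also have "(P ^ n) $ n + \<dots>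
          = (P ^ n * ((P - fps_X * fps_deriv P) * Q) + fps_X * fps_deriv P * (P ^ n * Q)) $ n"
        by (simp add: PQ)
      also have "P ^ n * ((P - fps_X * fps_deriv P) * Q) + fps_X * fps_deriv P * (P ^ n * Q)
          = P ^ (n + 1) * Q"
        by (simp add: algebra_simps)
      finally show ?thesis
        by (simp add: E_def)
    qed
    have "J 0 p n = E p n" for p
    proof (induction p)
      case (Suc p)
      then show ?case
        using step[of p 0] by (simp add: J_commute[of 0])
    qed (simp add: base)
    then show ?case
      by (induction h) (use step in simp_all)
  qed
  then show ?thesis
    by (simp add: J_def E_def add.assoc)
qed

section \<open>The sum of products of four binomial coefficients\<close>

text \<open>
  The polynomial variable is the \<open>u\<close> of \<open>(1 + u s)(1 + s)\<close>. It keeps apart the two factors, so that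
  a coefficient of a power is a single product of binomial coefficients. The exponent
  of \<open>s\<close> is the total degree and so determines the degree in the second factor.
\<close>
abbreviation quad_fps :: "real poly fps"
  where "quad_fps \<equiv> (1 + fps_const [:0, 1:] * fps_X) * (1 + fps_X)"

abbreviation (input) four_binomials :: "nat \<Rightarrow> nat \<Rightarrow> nat \<Rightarrow> nat \<Rightarrow> nat \<Rightarrow> nat \<Rightarrow> real"
  where "four_binomials c q h p i k \<equiv>
    real ((h + i + k) choose i) * real ((h + i + k) choose k) *
    (real ((p + (c - i) + (q - k)) choose (c - i)) * real ((p + (c - i) + (q - k)) choose (q - k)))"

lemma nth_linear_power:
  fixes c :: "'a::comm_ring_1"
  shows "((1 + fps_const c * fps_X) ^ M) $ m = of_nat (M choose m) * c ^ m"
proof (induction M arbitrary: m)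
  case (Suc M)
  then show ?case
    by (cases m) (simp_all add: algebra_simps)
qed (simp add: binomial_eq_0)

lemma coeff_quad_fps_power:
  "coeff ((quad_fps ^ M) $ m) i = (if i \<le> m then real (M choose i) * real (M choose (m - i)) else 0)"
proof -
  have *: "((1 + fps_X :: real poly fps) ^ M) $ m = of_nat (M choose m)" for m
    using nth_linear_power[of "1 :: real poly"] by simp
  have "(quad_fps ^ M) $ m
      = (\<Sum>j\<le>m. of_nat (M choose j) * [:0, 1:] ^ j * of_nat (M choose (m - j)))"
    unfolding power_mult_distrib fps_mult_nth nth_linear_power * atLeast0AtMost ..
  also have "\<dots> = (\<Sum>j\<le>m. monom (real (M choose j) * real (M choose (m - j))) j)"
    by (simp add: of_nat_poly monom_altdef mult_ac)
  finally show ?thesis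
    by (simp add: coeff_sum if_distrib cong: if_cong)
qed

text \<open>
  Both sides are the coefficient of \<open>u^c\<close> in the convolution identity for \<open>n = c + q\<close>: on the left
  \<open>s^(i+k) u^i\<close> is selected in the first factor, on the right \<open>u^j s^(2j)\<close> in the geometric series of
  \<open>1 / (1 - u s\<^sup>2)\<close>. The bound \<open>c \<le> q\<close> ensures that \<open>j\<close> runs up to \<open>c\<close>.
\<close>
lemma sum_four_binomials:
  assumes "c \<le> q"
  shows "(\<Sum>i\<le>c. \<Sum>k\<le>q. four_binomials c q h p i k)
       = (\<Sum>j\<le>c. real ((c + q + h + p + 1) choose (c - j)) * real ((c + q + h + p + 1) choose (q - j)))"
proof -
  define u :: "real poly" where "u = [:0, 1:]"
  define Q where "Q = Abs_fps (\<lambda>n. if even n then u ^ (n div 2) else 0)"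
  have "quad_fps - fps_X * fps_deriv quad_fps = 1 - fps_const u * fps_X ^ 2"
    by (simp add: algebra_simps u_def power2_eq_square)
  moreover have "(1 - fps_const u * fps_X ^ 2) * Q = 1"
  proof (rule fps_ext)
    fix n show "((1 - fps_const u * fps_X ^ 2) * Q) $ n = 1 $ n"
      by (cases n; cases "n - 1")
        (auto simp: Q_def left_diff_distrib mult.assoc fps_X_power_mult_nth)
  qed
  ultimately have "(quad_fps - fps_X * fps_deriv quad_fps) * Q = 1"
    by (simp only:)
  note conv = diag_convolution[OF this, where n = "c + q" and h = h and p = p]
  let ?D = "\<lambda>h s i. coeff (diag_coeff quad_fps h s) i"
  \<comment> \<open>In a fixed degree \<open>i\<close> of \<open>u\<close>, only the exponents \<open>i \<le> s \<le> i + q\<close> contribute, whence \<open>k = s - i\<close>.\<close>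
  have inner: "(\<Sum>s\<le>c + q. ?D h s i * ?D p (c + q - s) (c - i))
      = (\<Sum>k\<le>q. four_binomials c q h p i k)"
    if "i \<le> c" for i
  proof -
    have "(\<Sum>s\<le>c + q. ?D h s i * ?D p (c + q - s) (c - i))
       = (\<Sum>s\<in>{i..i + q}. ?D h s i * ?D p (c + q - s) (c - i))"
      by (rule sum.mono_neutral_right) (use that in \<open>auto simp: diag_coeff_def coeff_quad_fps_power\<close>)
    also have "\<dots> = (\<Sum>k\<le>q. ?D h (i + k) i * ?D p (c + q - (i + k)) (c - i))"
      by (rule sum.reindex_bij_witness[of _ "\<lambda>k. i + k" "\<lambda>s. s - i"]) auto
    also have "\<dots> = (\<Sum>k\<le>q. four_binomials c q h p i k)"
    proof (rule sum.cong[OF refl])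
      fix k assume "k \<in> {..q}"
      then have "c + q - (i + k) = (c - i) + (q - k)"
        using that by simp
      then show "?D h (i + k) i * ?D p (c + q - (i + k)) (c - i)
         = four_binomials c q h p i k"
        by (simp add: diag_coeff_def coeff_quad_fps_power add.assoc)
    qed
    finally show ?thesis .
  qed
  have "coeff (\<Sum>s\<le>c + q. diag_coeff quad_fps h s * diag_coeff quad_fps p (c + q - s)) c
     = (\<Sum>i\<le>c. \<Sum>s\<le>c + q. ?D h s i * ?D p (c + q - s) (c - i))"
    unfolding coeff_sum coeff_mult by (rule sum.swap)
  also have "\<dots> = (\<Sum>i\<le>c. \<Sum>k\<le>q. four_binomials c q h p i k)"
    by (intro sum.cong refl inner) simp
  finally have L:
    "coeff (\<Sum>s\<le>c + q. diag_coeff quad_fps h s * diag_coeff quad_fps p (c + q - s)) c = \<dots>" .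
  let ?M = "c + q + h + p + 1"
  have nth_term: "coeff (Q $ s * (quad_fps ^ ?M) $ (c + q - s)) c
      = (if even s \<and> s div 2 \<le> c
         then real (?M choose (c - s div 2)) * real (?M choose (q - s div 2)) else 0)"
    if "s \<le> c + q" for s
  proof (cases "even s")
    case True
    then obtain j where s: "s = 2 * j" by blast
    have "Q $ s = monom 1 j"
      by (simp add: Q_def s u_def monom_altdef)
    then have "coeff (Q $ s * (quad_fps ^ ?M) $ (c + q - s)) c
      = (if j \<le> c then coeff ((quad_fps ^ ?M) $ (c + q - s)) (c - j) else 0)"
      by (simp add: coeff_monom_mult)
    moreover have "c - j \<le> c + q - s" "c + q - s - (c - j) = q - j" if "j \<le> c"
      using that assms s by auto
    ultimately show ?thesis
      unfolding coeff_quad_fps_power by (simp add: s del: power_Suc)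
  qed (simp add: Q_def)
  have "coeff ((quad_fps ^ ?M * Q) $ (c + q)) c
     = (\<Sum>s\<le>c + q. if even s \<and> s div 2 \<le> c
         then real (?M choose (c - s div 2)) * real (?M choose (q - s div 2)) else 0)"
    unfolding mult.commute[of _ Q] fps_mult_nth coeff_sum atLeast0AtMost
    by (intro sum.cong refl nth_term) simp
  also have "\<dots> = (\<Sum>j\<le>c. real (?M choose (c - j)) * real (?M choose (q - j)))"
    unfolding sum.inter_filter[OF finite_atMost, symmetric]
    by (rule sum.reindex_bij_witness[of _ "\<lambda>j. 2 * j" "\<lambda>s. s div 2"]) (use assms in auto)
  finally show ?thesis
    using conv L by (simp only:)
qed

section \<open>From Pochhammer symbols to binomial coefficients\<close>

lemma pochhammer_nat_Suc: "pochhammer (real n + 1) k = fact (n + k) / fact n"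
proof -
  have "fact (n + k) = fact n * pochhammer (1 + real n) k"
    by (simp only: pochhammer_fact pochhammer_product')
  then show ?thesis
    by (simp add: add.commute)
qed

lemma pochhammer_neg_nat:
  assumes "k \<le> n"
  shows "pochhammer (- real n) k = (- 1) ^ k * fact n / fact (n - k)"
proof -
  have "real n - real k + 1 = real (n - k) + 1"
    using assms by simp
  then have "pochhammer (- real n) k = (- 1) ^ k * pochhammer (real (n - k) + 1) k"
    by (simp only: pochhammer_minus)
  then show ?thesis
    using assms by (simp only: pochhammer_nat_Suc) simp
qed

text \<open>
  The term with indices \<open>m = c - i\<close> and \<open>k\<close> of the double sum, after multiplication by the denominator
  of the prefactor. Replacing \<open>c\<close> and \<open>q\<close> by \<open>i + m\<close> and \<open>k + r\<close> removes all subtractions, so that both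
  sides become the same quotient of factorials; the signs cancel.
\<close>
lemma double_sum_term:
  assumes "i \<le> c" "k \<le> q"
  shows "real ((p + q) choose p) * real ((h + c) choose c) *
      ((pochhammer (- real c) (c - i) *
        pochhammer (real (p + q) + 1) (c - i) * pochhammer (real (p + q) + 1) (c - i)) /
       (pochhammer (real p + 1) (c - i) * fact (c - i) * pochhammer (- real (h + c)) (c - i))) *
      ((pochhammer (- real (p + q)) k * pochhammer (- real q) k *
        pochhammer (real (h + i) + 1) k * pochhammer (real (h + i) + 1) k) /
       (pochhammer (real h + 1) k * pochhammer (- real (p + q + (c - i))) k *
        pochhammer (- real (p + q + (c - i))) k * fact k))
    = four_binomials c q h p i k"
proof -
  define m where "m = c - i"
  define r where "r = q - k"
  have c: "c = i + m" and q: "q = k + r"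
    using assms by (auto simp: m_def r_def)
  have neg: "pochhammer (- real (i + m)) m = (- 1) ^ m * fact (i + m) / fact i"
    "pochhammer (- real (h + (i + m))) m = (- 1) ^ m * fact (h + i + m) / fact (h + i)"
    "pochhammer (- real (p + (k + r))) k = (- 1) ^ k * fact (p + k + r) / fact (p + r)"
    "pochhammer (- real (k + r)) k = (- 1) ^ k * fact (k + r) / fact r"
    "pochhammer (- real (p + (k + r) + m)) k = (- 1) ^ k * fact (p + k + r + m) / fact (p + m + r)"
    by (subst pochhammer_neg_nat; simp add: add_ac)+
  have binom: "real ((p + (k + r)) choose p) = fact (p + k + r) / (fact p * fact (k + r))"
    "real ((h + (i + m)) choose (i + m)) = fact (h + i + m) / (fact (i + m) * fact h)"
    "real ((h + i + k) choose i) = fact (h + i + k) / (fact i * fact (h + k))"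
    "real ((h + i + k) choose k) = fact (h + i + k) / (fact k * fact (h + i))"
    "real ((p + m + r) choose m) = fact (p + m + r) / (fact m * fact (p + r))"
    "real ((p + m + r) choose r) = fact (p + m + r) / (fact r * fact (p + m))"
    by (subst binomial_fact; simp add: add_ac)+
  have pos: "pochhammer (real (p + (k + r)) + 1) m = fact (p + k + r + m) / fact (p + k + r)"
    "pochhammer (real p + 1) m = fact (p + m) / fact p"
    "pochhammer (real (h + i) + 1) k = fact (h + i + k) / fact (h + i)"
    "pochhammer (real h + 1) k = fact (h + k) / fact h"
    by (subst pochhammer_nat_Suc; simp add: add_ac)+
  have sub: "i + m - i = m" "k + r - k = r"
    by simp_all
  show ?thesis
    unfolding c q sub neg binom pos
    by (simp add: divide_simps)
qed

lemma single_sum_term: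
  assumes "n \<le> c" "c \<le> q"
  shows "real ((p + q + h + c + 1) choose (q + h)) *
      ((pochhammer (- real (q + h)) (h + c - n) * (- 1) ^ (h + c - n) *
        pochhammer (real (p + q + h + c) + 2 - real n) n) /
       (pochhammer (real (p + c) + 2) (h + c - n) * fact n))
    = real ((p + q + h + c + 1) choose n) * real ((p + q + h + c + 1) choose (q - (c - n)))"
proof -
  define m where "m = c - n"
  define r where "r = q - c"
  have c: "c = n + m" and q: "q = n + m + r"
    using assms by (auto simp: m_def r_def)
  have sub: "h + (n + m) - n = h + m" "n + m - n = m" "n + m + r - m = n + r"
    by simp_all
  have "pochhammer (- real (n + m + r + h)) (h + m) = (- 1) ^ (h + m) * fact (n + m + r + h) / fact (n + r)"
    by (subst pochhammer_neg_nat; simp)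
  moreover have "pochhammer (real (p + (n + m + r) + h + (n + m)) + 2 - real n) n
      = fact (p + (n + m + r) + h + (n + m) + 1) / fact (p + (n + m + r) + h + m + 1)"
    using pochhammer_nat_Suc[of "p + (n + m + r) + h + m + 1" n] by (simp add: add_ac)
  moreover have "pochhammer (real (p + (n + m)) + 2) (h + m) = fact (p + n + m + 1 + h + m) / fact (p + n + m + 1)"
    using pochhammer_nat_Suc[of "p + n + m + 1" "h + m"] by (simp add: add_ac)
  moreover have "real ((p + (n + m + r) + h + (n + m) + 1) choose (n + m + r + h))
      = fact (p + (n + m + r) + h + (n + m) + 1) / (fact (n + m + r + h) * fact (p + n + m + 1))"
    by (subst binomial_fact; simp add: add_ac)
  moreover have "real ((p + (n + m + r) + h + (n + m) + 1) choose n)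
      = fact (p + (n + m + r) + h + (n + m) + 1) / (fact n * fact (p + (n + m + r) + h + m + 1))"
    by (subst binomial_fact; simp add: add_ac)
  moreover have "real ((p + (n + m + r) + h + (n + m) + 1) choose (n + r))
      = fact (p + (n + m + r) + h + (n + m) + 1) / (fact (n + r) * fact (p + n + m + 1 + h + m))"
    by (subst binomial_fact; simp add: add_ac)
  ultimately show ?thesis
    unfolding c q sub
    by (simp only:) (simp add: divide_simps del: fact_Suc)
qed

section \<open>The hypergeometric identity\<close>

theorem corollaryA2:
  fixes N a b c :: nat
  assumes "a \<le> N" and "b \<le> N" and "a \<le> b" and "N \<le> a + b" and "c \<le> N - b"
  shows "(\<Sum>m = 0..c.
            (pochhammer (- real c) m * pochhammer (real b + 1) m * pochhammer (real b + 1) m) /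
            (pochhammer (real N - real a - real c + 1) m * fact m * pochhammer (real b - real N) m) *
            hypergeo_4F3
              (- real b) (real N - real a - real b - real c)
              (real N - real b - real m + 1) (real N - real b - real m + 1)
              (real N - real b - real c + 1) (- real b - real m) (- real b - real m) 1)
       = real ((N + 1) choose a) /
           (real (b choose (N - a - c)) * real ((N - b) choose (N - b - c))) *
         (\<Sum>n = 0..c.
            (pochhammer (- real a) (N - b - n) * (- 1) ^ (N - b - n) * pochhammer (real N + 2 - real n) n) /
            (pochhammer (real N - real a + 2) (N - b - n) * fact n))"
    (is "(\<Sum>m = 0..c. ?F m * ?H m) = real ?A / (real ?B * real ?C) * (\<Sum>n = 0..c. ?R n)")
proof -
  define p where "p = N - a - c"
  define q where "q = a + b + c - N"
  define h where "h = N - b - c"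
  have b: "b = p + q" and N: "N = p + q + h + c" and a: "a = q + h" and cq: "c \<le> q"
    using assms by (auto simp: p_def q_def h_def)
  have BC: "?B = (p + q) choose p" "?C = (h + c) choose c"
    using binomial_symmetric[of h "h + c"] by (simp_all add: a b N)
  \<comment> \<open>The parameter \<open>-q\<close> stops the series at \<open>q \<le> b\<close>, no later than \<open>-b\<close> does.\<close>
  have series: "?H m = (\<Sum>k\<le>q.
      (pochhammer (- real (p + q)) k * pochhammer (- real q) k *
        pochhammer (real (h + (c - m)) + 1) k * pochhammer (real (h + (c - m)) + 1) k) /
       (pochhammer (real h + 1) k * pochhammer (- real (p + q + m)) k * pochhammer (- real (p + q + m)) k * fact k))"
    if "m \<le> c" for m
  proof -
    have args: "- real b = - real (p + q)" "real N - real a - real b - real c = - real q"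
      "real N - real b - real m + 1 = real (h + (c - m)) + 1" "real N - real b - real c + 1 = real h + 1"
      "- real b - real m = - real (p + q + m)"
      using that by (simp_all add: a b N)
    show ?thesis
      unfolding hypergeo_4F3_def args
      by (subst suminf_finite[of "{..q}"]) (auto simp: pochhammer_of_nat_eq_0_lemma)
  qed
  have F: "?F m =
      (pochhammer (- real c) m * pochhammer (real (p + q) + 1) m * pochhammer (real (p + q) + 1) m) /
       (pochhammer (real p + 1) m * fact m * pochhammer (- real (h + c)) m)" for m
  proof -
    have "real b = real (p + q)" "real N - real a - real c + 1 = real p + 1"
      "real b - real N = - real (h + c)"
      by (simp_all add: a b N)
    then show ?thesis by (simp only:)
  qed
  have "real ?B * real ?C * (\<Sum>m = 0..c. ?F m * ?H m)
      = real ?B * real ?C * (\<Sum>i\<le>c. ?F (c - i) * ?H (c - i))"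
    by (rule arg_cong[of _ _ "(*) _"])
      (rule sum.reindex_bij_witness[of _ "\<lambda>i. c - i" "\<lambda>i. c - i"]; auto)
  also have "\<dots> = (\<Sum>i\<le>c. \<Sum>k\<le>q. four_binomials c q h p i k)"
    unfolding sum_distrib_left
  proof (rule sum.cong[OF refl])
    fix i assume "i \<in> {..c}"
    then have i: "i \<le> c" "c - i \<le> c" "c - (c - i) = i" by auto
    show "real ?B * real ?C * (?F (c - i) * ?H (c - i)) = (\<Sum>k\<le>q. four_binomials c q h p i k)"
      unfolding series[OF i(2)] i(3) F BC mult.assoc[symmetric] sum_distrib_left
      by (intro sum.cong refl) (use double_sum_term[OF i(1)] in \<open>simp only: mult.assoc atMost_iff\<close>)
  qed
  also have "\<dots> = (\<Sum>j\<le>c. real ((c + q + h + p + 1) choose (c - j)) * real ((c + q + h + p + 1) choose (q - j)))"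
    by (rule sum_four_binomials[OF cq])
  also have "\<dots> = (\<Sum>n = 0..c. real ((p + q + h + c + 1) choose n) * real ((p + q + h + c + 1) choose (q - (c - n))))"
    by (rule sum.reindex_bij_witness[of _ "\<lambda>i. c - i" "\<lambda>i. c - i"]) (auto simp: add_ac)
  also have "\<dots> = (\<Sum>n = 0..c. real ?A * ?R n)"
  proof (intro sum.cong refl)
    fix n assume "n \<in> {0..c}"
    then have n: "n \<le> c" by simp
    have args: "real a = real (q + h)" "N - b - n = h + c - n" "real N = real (p + q + h + c)"
      "real (p + q + h + c) - real (q + h) + 2 = real (p + c) + 2"
      "?A = (p + q + h + c + 1) choose (q + h)"
      by (simp_all add: a b N)
    show "real ((p + q + h + c + 1) choose n) * real ((p + q + h + c + 1) choose (q - (c - n)))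
        = real ?A * ?R n"
      unfolding args by (rule single_sum_term[OF n cq, symmetric])
  qed
  finally have "real ?B * real ?C * (\<Sum>m = 0..c. ?F m * ?H m) = real ?A * (\<Sum>n = 0..c. ?R n)"
    by (simp only: sum_distrib_left)
  moreover have "real ?B * real ?C \<noteq> 0"
    unfolding BC by simp
  ultimately show ?thesis
    by (simp only: times_divide_eq_left eq_divide_eq mult.commute) simp
qed

end
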